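(* Let $d\ge 1$, $s\ge \frac12$, $\varepsilon>0$ and let $f,g\in\mathcal S^s_{s,\varepsilon}(\mathbb R^d)$. Then the short-time Fourier transform $V_gf$ belongs to $\mathcal S^s_{s,\delta}(\mathbb R^{2d})$ for every $\delta>0$ satisfying $$\begin{cases}\delta=\varepsilon/4, & s=1/2,\\ \delta<2^{1-\frac{3}{2s}}\,\varepsilon, & 1/2<s<1,\\ \delta<2^{-\frac{1}{2s}}\,\varepsilon, & s\ge 1.\end{cases}$$
   Context: The Fourier transform on $\mathbb R^n$ is $\hat f(\xi)=\int_{\mathbb R^n}e^{-2\pi i\xi\cdot x}f(x)\,dx$. For $n\ge 1$, $s\ge 1/2$ and $\varepsilon>0$, $\mathcal S^s_{s,\varepsilon}(\mathbb R^n)$ is the space of functions $f\in C^\infty(\mathbb R^n)$ (complex-valued) such that $\sup_{x}|f(x)|e^{\varepsilon|x|^{1/s}}<\infty$ and $\sup_{\xi}|\hat f(\xi)|e^{\varepsilon|\xi|^{1/s}}<\infty$. The short-time Fourier transform is $V_gf(x,\xi)=\int_{\mathbb R^d}e^{-2\pi i y\cdot\xi}f(y)\overline{g(y-x)}\,dy$, $(x,\xi)\in\mathbb R^{2d}$. *)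

theory Defs
  imports "HOL-Analysis.Analysis"
begin

text \<open>
  The spaces are defined over an arbitrary Euclidean space, so that they apply both to
  \<open>\<real>\<^sup>d\<close> and to \<open>\<real>\<^sup>2\<^sup>d\<close>, the latter taken as the product of two copies of \<open>\<real>\<^sup>d\<close>. The inner
  product, norm and Lebesgue measure of the product type are the usual Euclidean ones:
  \<open>(x, \<xi>) \<bullet> (a, b) = x \<bullet> a + \<xi> \<bullet> b\<close>.
\<close>

definition fourier_transform :: "('a::euclidean_space \<Rightarrow> complex) \<Rightarrow> 'a \<Rightarrow> complex" where
  "fourier_transform f \<xi> =
     (LINT x|lborel. exp (- 2 * complex_of_real pi * \<i> * complex_of_real (\<xi> \<bullet> x)) * f x)"

text \<open>
  For \<open>i \<in> Basis\<close>, \<open>frechet_derivative f (at x) i\<close> is the partial derivative of \<open>f\<close> at \<open>x\<close> in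
  the coordinate direction \<open>i\<close>.
\<close>

primrec C_k :: "nat \<Rightarrow> ('a::euclidean_space \<Rightarrow> complex) \<Rightarrow> bool" where
  "C_k 0 f \<longleftrightarrow> continuous_on UNIV f"
| "C_k (Suc k) f \<longleftrightarrow> (\<forall>x. f differentiable (at x)) \<and>
     (\<forall>i\<in>Basis. C_k k (\<lambda>x. frechet_derivative f (at x) i))"

definition C_infinity :: "('a::euclidean_space \<Rightarrow> complex) \<Rightarrow> bool" where
  "C_infinity f \<longleftrightarrow> (\<forall>k. C_k k f)"

text \<open>
  The Gelfand--Shilov type space \<open>S\<^sup>s\<^bsub>s,\<epsilon>\<^esub>\<close>. Since \<open>0 powr (1 / s) = 0\<close>, the weights have
  their expected value 1 at the origin.
\<close>

definition gelfand_shilov :: "real \<Rightarrow> real \<Rightarrow> ('a::euclidean_space \<Rightarrow> complex) set" where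
  "gelfand_shilov s \<epsilon> = {f. C_infinity f \<and>
     bdd_above (range (\<lambda>x. cmod (f x) * exp (\<epsilon> * norm x powr (1 / s)))) \<and>
     bdd_above (range (\<lambda>\<xi>. cmod (fourier_transform f \<xi>) * exp (\<epsilon> * norm \<xi> powr (1 / s))))}"

definition stft :: "('a::euclidean_space \<Rightarrow> complex) \<Rightarrow> ('a \<Rightarrow> complex) \<Rightarrow> 'a \<times> 'a \<Rightarrow> complex" where
  "stft g f = (\<lambda>(x, \<xi>).
     LINT y|lborel. exp (- 2 * complex_of_real pi * \<i> * complex_of_real (y \<bullet> \<xi>)) * f y * cnj (g (y - x)))"

end

theory Submission
  imports Defs "HOL-Probability.Characteristic_Functions" "HOL-Probability.Sinc_Integral"
begin

text \<open>
  Fourier inversion for \<open>g\<close> exhibits \<open>stft g f\<close> as the Fourier transform on the product space of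
  the kernel \<open>K (a, b) = e\<^bsup>2\<pi>i a \<bullet> b\<^esup> f(b) cnj (\<F> g (-a))\<close>, where \<open>\<F> g\<close> is the Fourier transform of
  \<open>g\<close>. As \<open>K\<close> decays like \<open>exp (-\<epsilon> |z|\<^sup>p)\<close> with \<open>p = 1 / s \<le> 2\<close>, its transform is smooth, and
  inversion on the product space gives \<open>K (-z)\<close> as the transform of \<open>stft g f\<close>. Integrating \<open>K\<close>
  first in \<open>a\<close> or first in \<open>b\<close> bounds \<open>|stft g f (x, \<xi>)|\<close> by the convolution of \<open>exp (-\<epsilon> |y|\<^sup>p)\<close>
  with itself at \<open>x\<close> and at \<open>\<xi>\<close>. That convolution decays by the triangle inequality for \<open>|\<cdot>|\<^sup>p\<close>
  (\<open>p \<le> 1\<close>), by convexity (\<open>1 < p < 2\<close>), or by completing the square (\<open>p = 2\<close>, where nothing is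
  lost to integrability), and \<open>|(x, \<xi>)| \<le> \<surd>2 max |x| |\<xi>|\<close> accounts for the remaining factor.
\<close>

section \<open>Integration over Euclidean spaces\<close>

lemma borel_measurable_cis [measurable (raw)]:
  "f \<in> borel_measurable M \<Longrightarrow> (\<lambda>x. cis (f x)) \<in> borel_measurable M"
  by (simp add: cis_conv_exp)

lemma borel_measurable_cnj [measurable (raw)]:
  assumes "f \<in> borel_measurable M"
  shows "(\<lambda>x. cnj (f x)) \<in> borel_measurable M"
  by (rule measurable_compose[OF assms borel_measurable_continuous_onI]) (intro continuous_intros)

text \<open>\<open>lborel_affine\<close> expresses Lebesgue measure as its affine image with a
  constant density; since \<open>c \<noteq> 0\<close>, that constant can be divided out.\<close>

lemma integrable_lborel_affine_iff:
  fixes f :: "'a::euclidean_space \<Rightarrow> 'b::{banach,second_countable_topology}"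
  assumes "c \<noteq> 0" and [measurable]: "f \<in> borel_measurable borel"
  shows "integrable lborel (\<lambda>x. f (t + c *\<^sub>R x)) \<longleftrightarrow> integrable lborel f"
proof -
  have "integrable lborel f \<longleftrightarrow> integrable (density (distr lborel borel (\<lambda>x. t + c *\<^sub>R x)) (\<lambda>_. ennreal (\<bar>c\<bar>^DIM('a)))) f"
    using lborel_affine[OF assms(1), of t] by (simp add: ennreal_power)
  also have "\<dots> \<longleftrightarrow> integrable lborel (\<lambda>x. \<bar>c\<bar>^DIM('a) *\<^sub>R f (t + c *\<^sub>R x))"
    by (subst integrable_density) (simp_all add: integrable_distr_eq)
  also have "\<dots> \<longleftrightarrow> integrable lborel (\<lambda>x. f (t + c *\<^sub>R x))"
  proof
    assume "integrable lborel (\<lambda>x. \<bar>c\<bar>^DIM('a) *\<^sub>R f (t + c *\<^sub>R x))"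
    from integrable_scaleR_right[OF this, of "inverse (\<bar>c\<bar>^DIM('a))"]
    show "integrable lborel (\<lambda>x. f (t + c *\<^sub>R x))"
      using assms(1) by simp
  qed simp
  finally show ?thesis by simp
qed

lemma integral_lborel_affine:
  fixes f :: "'a::euclidean_space \<Rightarrow> 'b::{banach,second_countable_topology}"
  assumes "c \<noteq> 0" and [measurable]: "f \<in> borel_measurable borel"
  shows "(LINT x|lborel. f x) = \<bar>c\<bar>^DIM('a) *\<^sub>R (LINT x|lborel. f (t + c *\<^sub>R x))"
proof -
  have "(LINT x|lborel. f x) = integral\<^sup>L (density (distr lborel borel (\<lambda>x. t + c *\<^sub>R x)) (\<lambda>_. ennreal (\<bar>c\<bar>^DIM('a)))) f"
    using lborel_affine[OF assms(1), of t] by (simp add: ennreal_power)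
  also have "\<dots> = (LINT x|lborel. \<bar>c\<bar>^DIM('a) *\<^sub>R f (t + c *\<^sub>R x))"
    by (subst integral_density) (simp_all add: integral_distr)
  finally show ?thesis by simp
qed

lemma integral_lborel_reflect:
  fixes f :: "'a::euclidean_space \<Rightarrow> 'b::{banach,second_countable_topology}"
  assumes "f \<in> borel_measurable borel"
  shows "(LINT x|lborel. f (t - x)) = (LINT x|lborel. f x)"
  using integral_lborel_affine[of "-1" f t] assms by auto

text \<open>By \<open>lborel_eq\<close>, Lebesgue measure is the image of a finite product of
  one-dimensional ones under the coordinate map, so Fubini for finite products applies. Gaussians
  and rational majorants are reduced to one variable this way.\<close>

lemma integrable_lborel_prod_Basis:
  fixes f :: "'a::euclidean_space \<Rightarrow> real \<Rightarrow> 'b::{real_normed_field,banach,second_countable_topology}"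
  assumes int: "\<And>b. b \<in> Basis \<Longrightarrow> integrable lborel (f b)"
  shows "integrable lborel (\<lambda>x. \<Prod>b\<in>Basis. f b (x \<bullet> b))"
    and "(LINT x|lborel. (\<Prod>b\<in>Basis. f b (x \<bullet> b))) = (\<Prod>b\<in>Basis. (LINT t|lborel. f b t))"
proof -
  interpret product_sigma_finite "\<lambda>_::'a. lborel :: real measure" ..
  have [measurable]: "\<And>b. b \<in> Basis \<Longrightarrow> f b \<in> borel_measurable borel"
    using int by auto
  have eq: "(\<Sum>b\<in>Basis. x b *\<^sub>R b) \<bullet> c = x c" if "c \<in> Basis" for x :: "'a \<Rightarrow> real" and c
    using that by simp
  show "integrable lborel (\<lambda>x. \<Prod>b\<in>Basis. f b (x \<bullet> b))"
    by (subst lborel_eq, subst integrable_distr_eq)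
       (auto simp: eq cong: prod.cong intro!: product_integrable_prod int)
  show "(LINT x|lborel. (\<Prod>b\<in>Basis. f b (x \<bullet> b))) = (\<Prod>b\<in>Basis. (LINT t|lborel. f b t))"
    by (subst lborel_eq, subst integral_distr)
       (auto simp: eq cong: prod.cong intro!: product_integral_prod int)
qed

section \<open>Power inequalities and integrability of exponential weights\<close>

lemma powr_add_le:
  fixes u v q :: real
  assumes "0 \<le> u" "0 \<le> v" "0 < q" "q \<le> 1"
  shows "(u + v) powr q \<le> u powr q + v powr q"
proof (cases "u + v = 0")
  case True
  then show ?thesis using assms by (simp add: add_nonneg_eq_0_iff)
next
  case False
  then have pos: "u + v > 0" using assms by linarith
  \<comment> \<open>After division by \<open>u + v\<close> each summand lies in [0, 1], where
    passing from exponent 1 to \<open>q \<le> 1\<close> does not decrease a number; the two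
    quotients add up to 1.\<close>
  have le: "w / (u + v) \<le> w powr q / (u + v) powr q" if "0 \<le> w" "w \<le> u + v" for w
  proof -
    have "w / (u + v) = (w / (u + v)) powr 1"
      using that pos by simp
    also have "\<dots> \<le> (w / (u + v)) powr q"
      using that pos assms by (intro powr_mono') (auto simp: divide_simps)
    also have "\<dots> = w powr q / (u + v) powr q"
      using that pos by (simp add: powr_divide)
    finally show ?thesis .
  qed
  have "1 = u / (u + v) + v / (u + v)"
    using pos by (simp add: add_divide_distrib[symmetric])
  also have "\<dots> \<le> u powr q / (u + v) powr q + v powr q / (u + v) powr q"
    using assms by (intro add_mono le) auto
  finally show ?thesis
    using pos by (simp add: add_divide_distrib[symmetric] field_simps)
qed

text \<open>Squared norms add up over the product, and the exponent \<open>p / 2\<close> left for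
  them is at most 1, so powers are subadditive. It lets a product of two decaying functions decay in
  the joint variable without loss of rate.\<close>

lemma norm_prod_powr_le:
  fixes a :: "'a::real_normed_vector" and b :: "'b::real_normed_vector"
  assumes "0 < p" "p \<le> 2"
  shows "norm (a, b) powr p \<le> norm a powr p + norm b powr p"
proof -
  have sq: "(r\<^sup>2) powr (p / 2) = r powr p" if "r \<ge> 0" for r :: real
    using that assms by (cases "r = 0") (auto simp: powr_powr simp flip: powr_numeral)
  have "norm (a, b) powr p = ((norm (a, b))\<^sup>2) powr (p / 2)"
    by (simp only: sq[OF norm_ge_zero])
  also have "\<dots> = ((norm a)\<^sup>2 + (norm b)\<^sup>2) powr (p / 2)"
    by (simp add: norm_Pair)
  also have "\<dots> \<le> ((norm a)\<^sup>2) powr (p / 2) + ((norm b)\<^sup>2) powr (p / 2)"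
    using assms by (intro powr_add_le) auto
  also have "\<dots> = norm a powr p + norm b powr p"
    by (simp add: sq)
  finally show ?thesis .
qed

lemma poly_le_exp_powr:
  fixes c p :: real
  assumes "0 < c" "0 < p"
  obtains C where "C > 0" "\<And>t. 0 \<le> t \<Longrightarrow> (1 + t) ^ N \<le> C * exp (c * t powr p)"
proof -
  \<comment> \<open>The choice N < p n gives t^N \<le> (t powr p)^n for t > 1.\<close>
  obtain n :: nat where n: "real N / p < real n"
    using reals_Archimedean2 by blast
  then have n0: "n > 0"
    using assms by (cases n) (auto simp: divide_less_0_iff)
  \<comment> \<open>With u = c (t powr p) / n one has (t powr p)^n = D u^n, and u \<le> exp u turns
    u^n into exp (c (t powr p)).\<close>
  define D where "D = (n / c) ^ n"
  have D: "D > 0" unfolding D_def using assms n0 by simp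
  have "(1 + t) ^ N \<le> 2 ^ N * (1 + D) * exp (c * t powr p)" if t: "0 \<le> t" for t
  proof (cases "t \<le> 1")
    case True
    have "(1 + t) ^ N \<le> 2 ^ N * 1 * 1"
      using t True power_mono[of "1 + t" 2 N] by simp
    also have "\<dots> \<le> 2 ^ N * (1 + D) * exp (c * t powr p)"
      using D assms by (intro mult_mono) auto
    finally show ?thesis .
  next
    case False
    then have t1: "t > 1" by simp
    have "t ^ N = t powr real N" using t1 by (simp add: powr_realpow)
    also have "\<dots> \<le> t powr (p * real n)"
      using n assms t1 by (intro powr_mono) (auto simp: field_simps)
    also have "\<dots> = (t powr p) ^ n"
      using t1 by (simp add: powr_powr[symmetric] powr_realpow)
    also have "\<dots> = D * (c * t powr p / n) ^ n"
      using assms n0 by (simp add: D_def power_mult_distrib power_divide)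
    also have "\<dots> \<le> D * exp (c * t powr p / n) ^ n"
    proof (intro mult_left_mono power_mono)
      show "c * t powr p / n \<le> exp (c * t powr p / n)"
        using exp_ge_add_one_self[of "c * t powr p / n"] by linarith
    qed (use D assms in auto)
    also have "exp (c * t powr p / n) ^ n = exp (c * t powr p)"
      using n0 by (simp flip: exp_of_nat_mult)
    finally have "t ^ N \<le> D * exp (c * t powr p)" .
    then have "2 ^ N * t ^ N \<le> 2 ^ N * ((1 + D) * exp (c * t powr p))"
      using D by (intro mult_left_mono) (auto simp: algebra_simps intro: order_trans)
    moreover have "(1 + t) ^ N \<le> (2 * t) ^ N"
      using t1 by (intro power_mono) auto
    ultimately show ?thesis
      by (simp only: power_mult_distrib mult.assoc)
  qed
  then show ?thesis using D by (intro that[of "2 ^ N * (1 + D)"]) auto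
qed

text \<open>Every coordinate is bounded by the norm, so the product of the integrable one-variable
  functions 1 / (1 + t^2), one per coordinate, is a majorant.\<close>

lemma integrable_inverse_poly:
  "integrable lborel (\<lambda>x::'a::euclidean_space. inverse ((1 + (norm x)\<^sup>2) ^ DIM('a)))"
proof -
  have "integrable lborel (\<lambda>t::real. inverse (1 + t\<^sup>2))"
    using integrable_inverse_1_plus_square by (simp add: set_integrable_def)
  note int = integrable_lborel_prod_Basis(1)[where 'a='a, of "\<lambda>_ t. inverse (1 + t\<^sup>2)", OF this]
  have le: "(\<Prod>b\<in>Basis. (1 + (x \<bullet> b)\<^sup>2)) \<le> (1 + (norm x)\<^sup>2) ^ DIM('a)" for x :: 'a
  proof -
    have "(\<Prod>b\<in>Basis. (1 + (x \<bullet> b)\<^sup>2)) \<le> (\<Prod>b\<in>(Basis::'a set). (1 + (norm x)\<^sup>2))"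
      using Basis_le_norm[of _ x] by (intro prod_mono) (auto simp flip: abs_le_square_iff)
    then show ?thesis by simp
  qed
  have pos: "(\<Prod>b\<in>Basis. (1 + (x \<bullet> b)\<^sup>2)) > 0" for x :: 'a
    by (intro prod_pos) (simp add: add_pos_nonneg)
  show ?thesis
  proof (rule Bochner_Integration.integrable_bound[OF int])
    show "AE x in lborel. norm (inverse ((1 + (norm (x::'a))\<^sup>2) ^ DIM('a)))
        \<le> norm (\<Prod>b\<in>Basis. inverse (1 + (x \<bullet> b)\<^sup>2))"
      using le_imp_inverse_le[OF le pos] pos
      by (auto simp: prod_inversef[unfolded comp_def] abs_of_nonneg prod_nonneg less_imp_le)
  qed auto
qed

lemma integrable_poly_exp:
  fixes c p :: real
  assumes "0 < c" "0 < p"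
  shows "integrable lborel (\<lambda>x::'a::euclidean_space. norm x ^ m * exp (- c * norm x powr p))"
proof -
  \<comment> \<open>Besides \<open>m\<close>, the exponent has to absorb the denominator of the
    integrable majorant, through 1 + |x|^2 \<le> (1 + |x|)^2.\<close>
  define N where "N = m + 2 * DIM('a)"
  obtain C where C: "C > 0" "\<And>t. 0 \<le> t \<Longrightarrow> (1 + t) ^ N \<le> C * exp (c * t powr p)"
    using poly_le_exp_powr[OF assms] by metis
  have le: "norm x ^ m * exp (- c * norm x powr p) \<le> C * inverse ((1 + (norm x)\<^sup>2) ^ DIM('a))" for x :: 'a
  proof -
    have "norm x ^ m * (1 + (norm x)\<^sup>2) ^ DIM('a) \<le> (1 + norm x) ^ m * ((1 + norm x)\<^sup>2) ^ DIM('a)"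
      by (intro mult_mono power_mono) (auto simp: power2_sum)
    also have "\<dots> = (1 + norm x) ^ N"
      by (simp add: N_def power_add power_mult)
    also have "\<dots> \<le> C * exp (c * norm x powr p)"
      by (rule C) simp
    finally show ?thesis
      by (simp add: exp_minus field_simps add_pos_nonneg)
  qed
  show ?thesis
    by (rule Bochner_Integration.integrable_bound[OF integrable_mult_right[OF integrable_inverse_poly, of C]])
       (use le C(1) in \<open>auto simp: abs_mult\<close>)
qed

section \<open>Differentiability of Fourier transforms\<close>

lemma exp_eq_cis: "exp (- 2 * complex_of_real pi * \<i> * complex_of_real t) = cis (- 2 * pi * t)"
  by (simp add: cis_conv_exp mult_ac)

lemma fourier_transform_cis:
  "fourier_transform f \<xi> = (LINT x|lborel. cis (- 2 * pi * (\<xi> \<bullet> x)) * f x)"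
  unfolding fourier_transform_def exp_eq_cis ..

lemma integrable_cis_mult:
  assumes "integrable M f" "\<phi> \<in> borel_measurable M"
  shows "integrable M (\<lambda>x. cis (\<phi> x) * f x)"
  by (rule Bochner_Integration.integrable_bound[OF assms(1)]) (use assms in \<open>auto simp: norm_mult\<close>)

text \<open>The second-order bound |e^(it) - 1 - it| \<le> t^2 / 2 under the integral leaves a
  remainder of size |\<eta> - \<xi>|^2 times the second moment of \<open>K\<close>, so
  differentiation under the integral needs no limit theorem.\<close>

lemma fourier_transform_has_derivative:
  fixes K :: "'a::euclidean_space \<Rightarrow> complex"
  assumes int: "\<And>m. integrable lborel (\<lambda>x. norm x ^ m *\<^sub>R K x)"
  shows "(fourier_transform K has_derivative
      (\<lambda>h. fourier_transform (\<lambda>x. - 2 * pi * \<i> * (h \<bullet> x) * K x) \<xi>)) (at \<xi>)"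
proof -
  have [measurable]: "K \<in> borel_measurable borel"
    using int[of 0] by auto
  have K: "integrable lborel K"
    using int[of 0] by simp
  have int2: "integrable lborel (\<lambda>x. norm x ^ 2 * norm (K x))"
    using integrable_norm[OF int[of 2]] by (simp add: norm_mult)
  have intd: "integrable lborel (\<lambda>x. - 2 * pi * \<i> * (h \<bullet> x) * K x)" for h
  proof (rule Bochner_Integration.integrable_bound[OF integrable_scaleR_right[OF int[of 1], of "2 * pi * norm h"]])
    show "AE x in lborel. norm (- 2 * pi * \<i> * (h \<bullet> x) * K x) \<le> norm ((2 * pi * norm h) *\<^sub>R norm x ^ 1 *\<^sub>R K x)"
      using mult_right_mono[OF Cauchy_Schwarz_ineq2 norm_ge_zero, of h _ "K _"]
      by (auto simp: norm_mult mult_ac)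
  qed auto
  define L where "L h = fourier_transform (\<lambda>x. - 2 * pi * \<i> * (h \<bullet> x) * K x) \<xi>" for h
  have intL: "integrable lborel (\<lambda>x. cis (- 2 * pi * (\<xi> \<bullet> x)) * (- 2 * pi * \<i> * (h \<bullet> x) * K x))" for h
    by (intro integrable_cis_mult intd) auto
  have intF: "integrable lborel (\<lambda>x. cis (- 2 * pi * (\<eta> \<bullet> x)) * K x)" for \<eta>
    by (intro integrable_cis_mult K) auto
  \<comment> \<open>A derivative must be a bounded linear map; in finite dimension linearity
    suffices.\<close>
  have "linear L"
  proof (rule linearI)
    show "L (a + b) = L a + L b" for a b
      unfolding L_def fourier_transform_cis
      by (subst Bochner_Integration.integral_add[OF intL intL, symmetric])
         (auto intro!: Bochner_Integration.integral_cong simp: inner_add_left algebra_simps)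
    show "L (r *\<^sub>R a) = r *\<^sub>R L a" for r a
    proof -
      have "L (r *\<^sub>R a) = (LINT x|lborel. r *\<^sub>R (cis (- 2 * pi * (\<xi> \<bullet> x)) * (- 2 * pi * \<i> * (a \<bullet> x) * K x)))"
        unfolding L_def fourier_transform_cis
        by (intro Bochner_Integration.integral_cong refl) (simp add: scaleR_conv_of_real mult_ac)
      then show ?thesis
        unfolding L_def fourier_transform_cis by (simp only: integral_scaleR_right)
    qed
  qed
  then have bl: "bounded_linear L"
    by (simp add: linear_conv_bounded_linear)
  \<comment> \<open>The constant is t^2 / 2 at t = -2 pi (h \<bullet> x), bounded by
    Cauchy-Schwarz.\<close>
  define B where "B = 2 * pi\<^sup>2 * (LINT x|lborel. norm x ^ 2 * norm (K x))"
  have est: "norm (fourier_transform K \<eta> - fourier_transform K \<xi> - L (\<eta> - \<xi>)) \<le> B * (norm (\<eta> - \<xi>))\<^sup>2" for \<eta>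
  proof -
    define h where "h = \<eta> - \<xi>"
    let ?t = "\<lambda>x. - 2 * pi * (h \<bullet> x)"
    have pt: "cis (- 2 * pi * (\<eta> \<bullet> x)) * K x - cis (- 2 * pi * (\<xi> \<bullet> x)) * K x
        - cis (- 2 * pi * (\<xi> \<bullet> x)) * (- 2 * pi * \<i> * (h \<bullet> x) * K x)
        = cis (- 2 * pi * (\<xi> \<bullet> x)) * (cis (?t x) - 1 - \<i> * ?t x) * K x" for x
    proof -
      have "cis (- 2 * pi * (\<eta> \<bullet> x)) = cis (- 2 * pi * (\<xi> \<bullet> x)) * cis (?t x)"
        by (simp add: cis_mult h_def algebra_simps)
      then show ?thesis by (simp add: algebra_simps)
    qed
    have rem: "norm (cis t - 1 - \<i> * t) \<le> t\<^sup>2 / 2" for t :: real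
      using iexp_approx1[of t 1] by (simp add: cis_conv_exp algebra_simps power2_eq_square)
    have le: "norm (cis (- 2 * pi * (\<xi> \<bullet> x)) * (cis (?t x) - 1 - \<i> * ?t x) * K x)
        \<le> (2 * pi\<^sup>2 * (norm h)\<^sup>2) * (norm x ^ 2 * norm (K x))" for x
    proof -
      have "norm (cis (- 2 * pi * (\<xi> \<bullet> x)) * (cis (?t x) - 1 - \<i> * ?t x) * K x)
          \<le> ((?t x)\<^sup>2 / 2) * norm (K x)"
        using mult_right_mono[OF rem[of "?t x"] norm_ge_zero[of "K x"]] by (simp add: norm_mult)
      also have "(?t x)\<^sup>2 / 2 = 2 * pi\<^sup>2 * (h \<bullet> x)\<^sup>2"
        by (simp add: power_mult_distrib)
      also have "\<dots> * norm (K x) \<le> (2 * pi\<^sup>2 * (norm h * norm x)\<^sup>2) * norm (K x)"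
        using Cauchy_Schwarz_ineq2[of h x]
        by (intro mult_right_mono mult_left_mono) (auto simp flip: abs_le_square_iff simp: abs_mult)
      finally show ?thesis by (simp add: power_mult_distrib mult_ac)
    qed
    have "fourier_transform K \<eta> - fourier_transform K \<xi> - L h
        = (LINT x|lborel. cis (- 2 * pi * (\<xi> \<bullet> x)) * (cis (?t x) - 1 - \<i> * ?t x) * K x)"
      unfolding L_def fourier_transform_cis pt[symmetric]
      by (simp only: Bochner_Integration.integral_diff Bochner_Integration.integrable_diff intF intL)
    also have "norm \<dots> \<le> (LINT x|lborel. (2 * pi\<^sup>2 * (norm h)\<^sup>2) * (norm x ^ 2 * norm (K x)))"
    proof (rule Bochner_Integration.integral_norm_bound_integral)
      show "integrable lborel (\<lambda>x. cis (- 2 * pi * (\<xi> \<bullet> x)) * (cis (?t x) - 1 - \<i> * ?t x) * K x)"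
        unfolding pt[symmetric] by (intro Bochner_Integration.integrable_diff intF intL)
      show "integrable lborel (\<lambda>x. (2 * pi\<^sup>2 * (norm h)\<^sup>2) * (norm x ^ 2 * norm (K x)))"
        by (intro integrable_mult_right int2)
    qed (rule le)
    also have "\<dots> = B * (norm h)\<^sup>2"
      by (simp add: B_def)
    finally show ?thesis unfolding h_def .
  qed
  have "(fourier_transform K has_derivative L) (at \<xi>)"
  proof (rule has_derivativeI_sandwich[where e = 1 and H = "\<lambda>\<eta>. B * norm (\<eta> - \<xi>)"])
    show "norm (fourier_transform K \<eta> - fourier_transform K \<xi> - L (\<eta> - \<xi>)) / norm (\<eta> - \<xi>) \<le> B * norm (\<eta> - \<xi>)"
      if "\<eta> \<noteq> \<xi>" for \<eta>
      using est[of \<eta>] that by (simp add: divide_le_eq power2_eq_square mult.assoc)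
    show "((\<lambda>\<eta>. B * norm (\<eta> - \<xi>)) \<longlongrightarrow> 0) (at \<xi>)"
      by (auto intro!: tendsto_eq_intros)
  qed (use bl in auto)
  then show ?thesis unfolding L_def .
qed

text \<open>A partial derivative is again a Fourier transform, of \<open>K\<close> times a linear
  factor, and its moment \<open>m\<close> is controlled by moment \<open>Suc m\<close> of
  \<open>K\<close>. The hypothesis on all moments thus reproduces itself, and induction on the order
  works with \<open>K\<close> arbitrary.\<close>

lemma C_infinity_fourier_transform:
  fixes K :: "'a::euclidean_space \<Rightarrow> complex"
  assumes "\<And>m. integrable lborel (\<lambda>x. norm x ^ m *\<^sub>R K x)"
  shows "C_infinity (fourier_transform K)"
proof -
  have "C_k k (fourier_transform K)" if "\<And>m. integrable lborel (\<lambda>x. norm x ^ m *\<^sub>R K x)"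
    for k and K :: "'a \<Rightarrow> complex"
    using that
  proof (induction k arbitrary: K)
    case 0
    show ?case
      using fourier_transform_has_derivative[OF 0]
      by (auto intro!: continuous_at_imp_continuous_on has_derivative_continuous)
  next
    case (Suc k)
    note D = fourier_transform_has_derivative[OF Suc.prems]
    have [measurable]: "K \<in> borel_measurable borel"
      using Suc.prems[of 0] by auto
    have "C_k k (fourier_transform (\<lambda>x. - 2 * pi * \<i> * (i \<bullet> x) * K x))" if "i \<in> Basis" for i
    proof (rule Suc.IH)
      fix m
      show "integrable lborel (\<lambda>x. norm x ^ m *\<^sub>R (- 2 * pi * \<i> * (i \<bullet> x) * K x))"
      proof (rule Bochner_Integration.integrable_bound[OF integrable_scaleR_right[OF Suc.prems[of "Suc m"], of "2 * pi"]])
        have "\<bar>i \<bullet> x\<bar> * (cmod (K x) * norm x ^ m) \<le> norm x * (cmod (K x) * norm x ^ m)" for x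
          using Basis_le_norm[OF that, of x] by (intro mult_right_mono) (auto simp: inner_commute)
        then show "AE x in lborel. norm (norm x ^ m *\<^sub>R (- 2 * pi * \<i> * (i \<bullet> x) * K x))
            \<le> norm ((2 * pi) *\<^sub>R norm x ^ Suc m *\<^sub>R K x)"
          by (auto simp: norm_mult mult_ac)
      qed auto
    qed
    moreover have "(\<lambda>\<xi>. frechet_derivative (fourier_transform K) (at \<xi>) i)
        = fourier_transform (\<lambda>x. - 2 * pi * \<i> * (i \<bullet> x) * K x)" for i
      by (rule ext) (simp add: frechet_derivative_at[OF D, symmetric])
    ultimately show ?case
      using D by (auto simp: differentiable_def)
  qed
  with assms show ?thesis by (simp add: C_infinity_def)
qed

section \<open>Fourier inversion\<close>

text \<open>The factor \<open>pi\<close> in the exponent makes this a fixed point of the Fourier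
  transform, of total mass 1.\<close>

definition gaussian :: "'a::euclidean_space \<Rightarrow> real" where
  "gaussian x = exp (- pi * (norm x)\<^sup>2)"

lemma gaussian_real:
  shows "integrable lborel (\<lambda>t::real. complex_of_real (exp (- pi * t\<^sup>2)))"
    and "(LINT t|lborel. cis (- 2 * pi * (\<xi> * t)) * exp (- pi * t\<^sup>2)) = exp (- pi * \<xi>\<^sup>2)"
proof -
  \<comment> \<open>The substitution u = r t carries exp (-u^2 / 2) to exp (-pi t^2), and the
    Jacobian \<open>r\<close> cancels the normalisation of the standard normal density, whose
    characteristic function is known.\<close>
  define r where "r = sqrt (2 * pi)"
  have r: "r > 0" "r\<^sup>2 = 2 * pi" by (simp_all add: r_def)
  have dens: "std_normal_density (r * t) = exp (- pi * t\<^sup>2) / r" for t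
    using r(2) by (simp add: std_normal_density_def r_def[symmetric] power_mult_distrib)
  have int: "integrable lborel (\<lambda>t::real. exp (- pi * t\<^sup>2))"
    using integrable_poly_exp[of pi 2 0, where 'a=real] by simp
  then show "integrable lborel (\<lambda>t::real. complex_of_real (exp (- pi * t\<^sup>2)))"
    by (rule integrable_of_real)
  have "exp (- pi * \<xi>\<^sup>2) = exp (- ((- r * \<xi>)\<^sup>2) / 2)"
    using r(2) by (simp add: power_mult_distrib)
  also have "complex_of_real \<dots> = char std_normal_distribution (- r * \<xi>)"
    by (simp add: char_std_normal_distribution)
  also have "\<dots> = (LINT t|lborel. std_normal_density t *\<^sub>R iexp (- r * \<xi> * t))"
    unfolding char_def by (subst integral_density) auto
  also have "\<dots> = \<bar>r\<bar> ^ DIM(real) *\<^sub>R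
      (LINT t|lborel. std_normal_density (0 + r *\<^sub>R t) *\<^sub>R iexp (- r * \<xi> * (0 + r *\<^sub>R t)))"
    using r(1) by (intro integral_lborel_affine) auto
  also have "\<dots> = r *\<^sub>R (LINT t|lborel. std_normal_density (r * t) *\<^sub>R iexp (- r * \<xi> * (r * t)))"
    by (simp only: DIM_real power_one_right abs_of_pos[OF r(1)] add_0 real_scaleR_def)
  also have "\<dots> = (LINT t|lborel. cis (- 2 * pi * (\<xi> * t)) * exp (- pi * t\<^sup>2))"
  proof (subst integral_scaleR_right[symmetric], intro Bochner_Integration.integral_cong refl)
    fix t :: real
    have "- r * \<xi> * (r * t) = - 2 * pi * (\<xi> * t)"
      using r(2) by (simp add: power2_eq_square mult_ac)
    then have "iexp (- r * \<xi> * (r * t)) = cis (- 2 * pi * (\<xi> * t))"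
      unfolding cis_conv_exp by (simp only:)
    then show "r *\<^sub>R std_normal_density (r * t) *\<^sub>R iexp (- r * \<xi> * (r * t)) = cis (- 2 * pi * (\<xi> * t)) * exp (- pi * t\<^sup>2)"
      using r(1) by (simp only: dens) (simp add: scaleR_conv_of_real)
  qed
  finally show "(LINT t|lborel. cis (- 2 * pi * (\<xi> * t)) * exp (- pi * t\<^sup>2)) = exp (- pi * \<xi>\<^sup>2)" ..
qed

lemma integrable_gaussian: "integrable lborel (gaussian :: 'a::euclidean_space \<Rightarrow> real)"
  using integrable_poly_exp[of pi 2 0, where 'a='a] by (simp add: gaussian_def[abs_def])

text \<open>Both the Gaussian and the character factor over the coordinates, which leaves a product
  of one-dimensional transforms.\<close>

lemma fourier_transform_gaussian:
  "fourier_transform (\<lambda>x. complex_of_real (gaussian x)) (\<xi>::'a::euclidean_space) = gaussian \<xi>"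
proof -
  have "(norm x)\<^sup>2 = (\<Sum>b\<in>Basis. (x \<bullet> b)\<^sup>2)" for x :: 'a
    unfolding power2_norm_eq_inner by (subst euclidean_inner) (simp only: power2_eq_square)
  then have g: "gaussian x = (\<Prod>b\<in>Basis. exp (- pi * (x \<bullet> b)\<^sup>2))" for x :: 'a
    by (simp add: gaussian_def exp_sum sum_distrib_left flip: sum_negf)
  have c: "cis (- 2 * pi * (\<xi> \<bullet> x)) = (\<Prod>b\<in>Basis. cis (- 2 * pi * ((\<xi> \<bullet> b) * (x \<bullet> b))))" for x
    by (simp add: cis_conv_exp exp_sum[symmetric] sum_distrib_left euclidean_inner[of \<xi> x] sum_negf)
  have "fourier_transform (\<lambda>x. complex_of_real (gaussian x)) \<xi>
     = (LINT x|lborel. (\<Prod>b\<in>Basis. cis (- 2 * pi * ((\<xi> \<bullet> b) * (x \<bullet> b))) * exp (- pi * (x \<bullet> b)\<^sup>2)))"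
    unfolding fourier_transform_cis g c by (simp add: prod.distrib)
  also have "\<dots> = (\<Prod>b\<in>Basis. (LINT t|lborel. cis (- 2 * pi * ((\<xi> \<bullet> b) * t)) * exp (- pi * t\<^sup>2)))"
    by (rule integrable_lborel_prod_Basis(2)[where f = "\<lambda>b t. cis (- 2 * pi * ((\<xi> \<bullet> b) * t)) * exp (- pi * t\<^sup>2)"])
       (intro integrable_cis_mult gaussian_real; simp)
  also have "\<dots> = gaussian \<xi>"
    by (simp only: gaussian_real(2) g of_real_prod)
  finally show ?thesis .
qed

text \<open>A Gaussian factor G (t \<xi>) makes the double integral absolutely convergent, so Fubini
  rewrites it as a Gaussian average of \<open>f\<close> around \<open>x\<close> at scale t.
  Dominated convergence as t tends to 0 then applies to both sides.\<close>

lemma fourier_inversion: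
  fixes f :: "'a::euclidean_space \<Rightarrow> complex"
  assumes cont: "continuous_on UNIV f" and bdd: "\<And>x. norm (f x) \<le> B"
    and int: "integrable lborel f" and int_hat: "integrable lborel (fourier_transform f)"
  shows "(LINT \<xi>|lborel. cis (2 * pi * (x \<bullet> \<xi>)) * fourier_transform f \<xi>) = f x"
proof -
  have f_meas [measurable]: "f \<in> borel_measurable borel"
    using int by auto
  have ft_meas [measurable]: "fourier_transform f \<in> borel_measurable borel"
    using int_hat by auto
  have [measurable]: "gaussian \<in> borel_measurable (borel :: 'a measure)"
    unfolding gaussian_def by measurable
  define G :: "'a \<Rightarrow> complex" where "G x = gaussian x" for x
  have G_meas [measurable]: "G \<in> borel_measurable borel"
    unfolding G_def by measurable
  have G_int: "integrable lborel G"
    using integrable_gaussian[THEN integrable_of_real] by (simp add: G_def[abs_def])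
  have G_even: "G (- z) = G z" for z by (simp add: G_def gaussian_def)
  have G_le: "norm (G z) \<le> 1" for z by (simp add: G_def gaussian_def)
  \<comment> \<open>A Gaussian dilated by t transforms into one concentrated at scale t with
    unchanged mass, that is, an approximate identity.\<close>
  have G_scale: "(LINT \<xi>|lborel. cis (2 * pi * (w \<bullet> \<xi>)) * G (t *\<^sub>R \<xi>)) = inverse t ^ DIM('a) *\<^sub>R G (w /\<^sub>R t)"
    if "t > 0" for t w
  proof -
    have "(LINT \<xi>|lborel. cis (2 * pi * (w \<bullet> \<xi>)) * G (t *\<^sub>R \<xi>))
        = inverse t ^ DIM('a) *\<^sub>R (LINT \<eta>|lborel. cis (2 * pi * (w \<bullet> (\<eta> /\<^sub>R t))) * G \<eta>)"
      using integral_lborel_affine[of "inverse t" "\<lambda>\<xi>. cis (2 * pi * (w \<bullet> \<xi>)) * G (t *\<^sub>R \<xi>)" 0] that by simp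
    also have "(LINT \<eta>|lborel. cis (2 * pi * (w \<bullet> (\<eta> /\<^sub>R t))) * G \<eta>) = fourier_transform G (- (w /\<^sub>R t))"
      unfolding fourier_transform_cis by simp
    also have "\<dots> = G (w /\<^sub>R t)"
      unfolding G_even[of "w /\<^sub>R t", symmetric] unfolding G_def by (rule fourier_transform_gaussian)
    finally show ?thesis .
  qed
  have smoothed: "(LINT \<xi>|lborel. cis (2 * pi * (x \<bullet> \<xi>)) * fourier_transform f \<xi> * G (t *\<^sub>R \<xi>))
      = (LINT z|lborel. f (x + t *\<^sub>R z) * G z)" if "t > 0" for t
  proof -
    have Gt: "integrable lborel (\<lambda>\<xi>. G (t *\<^sub>R \<xi>))"
      using integrable_lborel_affine_iff[of t G 0] that G_int by simp
    have "integrable (lborel \<Otimes>\<^sub>M lborel) (\<lambda>(\<xi>, y). G (t *\<^sub>R \<xi>) * f y)"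
      using Gt int by (intro lborel_pair.Fubini_integrable) (auto simp: norm_mult)
    then have pint: "integrable (lborel \<Otimes>\<^sub>M lborel) (\<lambda>(\<xi>, y). cis (2 * pi * ((x - y) \<bullet> \<xi>)) * (G (t *\<^sub>R \<xi>) * f y))"
      using integrable_cis_mult[of "lborel \<Otimes>\<^sub>M lborel" "\<lambda>(\<xi>, y). G (t *\<^sub>R \<xi>) * f y" "\<lambda>(\<xi>, y). 2 * pi * ((x - y) \<bullet> \<xi>)"]
      by (simp add: case_prod_unfold)
    have "(LINT \<xi>|lborel. cis (2 * pi * (x \<bullet> \<xi>)) * fourier_transform f \<xi> * G (t *\<^sub>R \<xi>))
       = (LINT \<xi>|lborel. (LINT y|lborel. cis (2 * pi * ((x - y) \<bullet> \<xi>)) * (G (t *\<^sub>R \<xi>) * f y)))"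
    proof (intro Bochner_Integration.integral_cong refl)
      fix \<xi> :: 'a
      have "cis (2 * pi * (x \<bullet> \<xi>)) * fourier_transform f \<xi> * G (t *\<^sub>R \<xi>)
          = cis (2 * pi * (x \<bullet> \<xi>)) * G (t *\<^sub>R \<xi>) * fourier_transform f \<xi>"
        by (simp add: mult_ac)
      also have "\<dots> = (LINT y|lborel. cis (2 * pi * (x \<bullet> \<xi>)) * G (t *\<^sub>R \<xi>) * (cis (- 2 * pi * (\<xi> \<bullet> y)) * f y))"
        unfolding fourier_transform_cis by simp
      also have "\<dots> = (LINT y|lborel. cis (2 * pi * ((x - y) \<bullet> \<xi>)) * (G (t *\<^sub>R \<xi>) * f y))"
      proof (intro Bochner_Integration.integral_cong refl)
        fix y
        have "cis (2 * pi * ((x - y) \<bullet> \<xi>)) = cis (2 * pi * (x \<bullet> \<xi>)) * cis (- 2 * pi * (\<xi> \<bullet> y))"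
          by (simp add: cis_mult inner_diff_left inner_commute algebra_simps)
        then show "cis (2 * pi * (x \<bullet> \<xi>)) * G (t *\<^sub>R \<xi>) * (cis (- 2 * pi * (\<xi> \<bullet> y)) * f y)
            = cis (2 * pi * ((x - y) \<bullet> \<xi>)) * (G (t *\<^sub>R \<xi>) * f y)"
          by (simp add: mult_ac)
      qed
      finally show "cis (2 * pi * (x \<bullet> \<xi>)) * fourier_transform f \<xi> * G (t *\<^sub>R \<xi>)
          = (LINT y|lborel. cis (2 * pi * ((x - y) \<bullet> \<xi>)) * (G (t *\<^sub>R \<xi>) * f y))" .
    qed
    also have "\<dots> = (LINT y|lborel. (LINT \<xi>|lborel. cis (2 * pi * ((x - y) \<bullet> \<xi>)) * (G (t *\<^sub>R \<xi>) * f y)))"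
      using lborel_pair.Fubini_integral[OF pint] ..
    also have "\<dots> = (LINT y|lborel. f y * (inverse t ^ DIM('a) *\<^sub>R G ((x - y) /\<^sub>R t)))"
    proof (intro Bochner_Integration.integral_cong refl)
      fix y
      have "(LINT \<xi>|lborel. cis (2 * pi * ((x - y) \<bullet> \<xi>)) * (G (t *\<^sub>R \<xi>) * f y))
          = (LINT \<xi>|lborel. f y * (cis (2 * pi * ((x - y) \<bullet> \<xi>)) * G (t *\<^sub>R \<xi>)))"
        by (intro Bochner_Integration.integral_cong refl) (simp only: mult_ac)
      then show "(LINT \<xi>|lborel. cis (2 * pi * ((x - y) \<bullet> \<xi>)) * (G (t *\<^sub>R \<xi>) * f y))
          = f y * (inverse t ^ DIM('a) *\<^sub>R G ((x - y) /\<^sub>R t))"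
        by (simp only: integral_mult_right_zero G_scale[OF that])
    qed
    \<comment> \<open>Substituting y = x + t z fixes the weight and moves the scale into the
      argument of \<open>f\<close>, where continuity can be used.\<close>
    also have "\<dots> = \<bar>t\<bar> ^ DIM('a) *\<^sub>R (LINT z|lborel. f (x + t *\<^sub>R z) * (inverse t ^ DIM('a) *\<^sub>R G (- z)))"
      using that integral_lborel_affine[of t "\<lambda>y. f y * (inverse t ^ DIM('a) *\<^sub>R G ((x - y) /\<^sub>R t))" x] by simp
    also have "\<dots> = (LINT z|lborel. f (x + t *\<^sub>R z) * G z)"
      using that by (simp add: G_even power_inverse)
    finally show ?thesis .
  qed
  define \<tau> where "\<tau> n = inverse (real (Suc n))" for n
  have \<tau>: "\<tau> n > 0" for n by (simp add: \<tau>_def)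
  have \<tau>0: "\<tau> \<longlonglongrightarrow> 0" unfolding \<tau>_def by (rule LIMSEQ_inverse_real_of_nat)
  have G0: "isCont G 0" unfolding G_def gaussian_def by (intro continuous_intros)
  have "(\<lambda>n. LINT \<xi>|lborel. cis (2 * pi * (x \<bullet> \<xi>)) * fourier_transform f \<xi> * G (\<tau> n *\<^sub>R \<xi>))
      \<longlonglongrightarrow> (LINT \<xi>|lborel. cis (2 * pi * (x \<bullet> \<xi>)) * fourier_transform f \<xi>)"
  \<comment> \<open>Since |G| \<le> 1, integrability of the transform supplies the majorant; in the
    second limit the bound on \<open>f\<close> and integrability of \<open>G\<close> do.\<close>
  proof (rule integral_dominated_convergence[where w = "\<lambda>\<xi>. norm (fourier_transform f \<xi>)"])
    show "AE \<xi> in lborel. (\<lambda>n. cis (2 * pi * (x \<bullet> \<xi>)) * fourier_transform f \<xi> * G (\<tau> n *\<^sub>R \<xi>))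
        \<longlonglongrightarrow> cis (2 * pi * (x \<bullet> \<xi>)) * fourier_transform f \<xi>"
    proof (rule AE_I2)
      fix \<xi> :: 'a
      have "(\<lambda>n. \<tau> n *\<^sub>R \<xi>) \<longlonglongrightarrow> 0"
        using tendsto_scaleR[OF \<tau>0 tendsto_const[of \<xi>]] by simp
      then have "(\<lambda>n. G (\<tau> n *\<^sub>R \<xi>)) \<longlonglongrightarrow> G 0"
        by (rule isCont_tendsto_compose[OF G0])
      from tendsto_mult[OF tendsto_const this]
      show "(\<lambda>n. cis (2 * pi * (x \<bullet> \<xi>)) * fourier_transform f \<xi> * G (\<tau> n *\<^sub>R \<xi>))
          \<longlonglongrightarrow> cis (2 * pi * (x \<bullet> \<xi>)) * fourier_transform f \<xi>"
        by (simp add: G_def gaussian_def)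
    qed
  qed (use int_hat G_le in \<open>auto simp: norm_mult mult_left_le\<close>)
  moreover have "(\<lambda>n. LINT z|lborel. f (x + \<tau> n *\<^sub>R z) * G z) \<longlonglongrightarrow> (LINT z|lborel. f x * G z)"
  proof (rule integral_dominated_convergence[where w = "\<lambda>z. B * norm (G z)"])
    show "AE z in lborel. (\<lambda>n. f (x + \<tau> n *\<^sub>R z) * G z) \<longlonglongrightarrow> f x * G z"
    proof (rule AE_I2)
      fix z :: 'a
      have "(\<lambda>n. x + \<tau> n *\<^sub>R z) \<longlonglongrightarrow> x"
        using tendsto_add[OF tendsto_const tendsto_scaleR[OF \<tau>0 tendsto_const[of z]], of x] by simp
      then have "(\<lambda>n. f (x + \<tau> n *\<^sub>R z)) \<longlonglongrightarrow> f x"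
        using cont by (intro isCont_tendsto_compose[of x f]) (auto simp: continuous_on_eq_continuous_at)
      then show "(\<lambda>n. f (x + \<tau> n *\<^sub>R z) * G z) \<longlonglongrightarrow> f x * G z"
        by (intro tendsto_intros)
    qed
  qed (use G_int bdd in \<open>auto simp: norm_mult intro!: mult_right_mono\<close>)
  moreover have "(LINT z|lborel. G z) = 1"
    using fourier_transform_gaussian[of "0::'a"] by (simp add: fourier_transform_cis G_def gaussian_def)
  ultimately show ?thesis
    unfolding smoothed[OF \<tau>] by (auto dest: LIMSEQ_unique)
qed

section \<open>Self-convolution of exponential weights\<close>

lemma norm_powr_triangle:
  fixes x y :: "'a::real_normed_vector"
  assumes "0 < p" "p \<le> 1"
  shows "norm x powr p \<le> norm y powr p + norm (x - y) powr p"
proof -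
  have "norm x powr p \<le> (norm y + norm (x - y)) powr p"
    using assms norm_triangle_ineq[of y "x - y"] by (intro powr_mono2) auto
  also have "\<dots> \<le> norm y powr p + norm (x - y) powr p"
    using assms by (intro powr_add_le) auto
  finally show ?thesis .
qed

text \<open>This is convexity of the power at the midpoint, doubled: the left side equals 2 ((u + v)
  / 2)^p.\<close>

lemma powr_midpoint_le:
  fixes u v p :: real
  assumes "0 \<le> u" "0 \<le> v" "1 \<le> p"
  shows "2 powr (1 - p) * (u + v) powr p \<le> u powr p + v powr p"
proof (cases "u = 0 \<or> v = 0")
  case True
  have "2 powr (1 - p) * w powr p \<le> w powr p" for w :: real
    using assms powr_mono[of "1 - p" 0 2] by (intro mult_left_le_one_le) auto
  then show ?thesis using True assms by auto
next
  case False
  then have pos: "u > 0" "v > 0" using assms by auto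
  have "((1 - 1 / 2) *\<^sub>R u + (1 / 2) *\<^sub>R v) powr p \<le> (1 - 1 / 2) * u powr p + (1 / 2) * v powr p"
    by (rule convex_onD[OF powr_convex[OF assms(3)]]) (use pos in auto)
  then have "((u + v) / 2) powr p \<le> (u powr p + v powr p) / 2"
    by (simp add: field_simps)
  moreover have "2 powr (1 - p) * (u + v) powr p = 2 * ((u + v) / 2) powr p"
    using pos by (simp add: powr_divide powr_diff)
  ultimately show ?thesis by simp
qed

lemma norm_powr_midpoint_le:
  fixes x y :: "'a::real_normed_vector"
  assumes "1 \<le> p"
  shows "2 powr (1 - p) * norm x powr p \<le> norm y powr p + norm (x - y) powr p"
proof -
  have "2 powr (1 - p) * norm x powr p \<le> 2 powr (1 - p) * (norm y + norm (x - y)) powr p"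
    using assms norm_triangle_ineq[of y "x - y"] by (intro mult_left_mono powr_mono2) auto
  also have "\<dots> \<le> norm y powr p + norm (x - y) powr p"
    using assms by (intro powr_midpoint_le) auto
  finally show ?thesis .
qed

lemma integrable_exp_powr_convolution:
  fixes x :: "'a::euclidean_space"
  assumes "0 < p" "0 < \<epsilon>"
  shows "integrable lborel (\<lambda>y. exp (- \<epsilon> * (norm y powr p + norm (x - y) powr p)))"
proof (rule Bochner_Integration.integrable_bound)
  show "integrable lborel (\<lambda>y::'a. exp (- \<epsilon> * norm y powr p))"
    using integrable_poly_exp[OF assms(2,1), of 0, where 'a='a] by simp
  show "AE y in lborel. norm (exp (- \<epsilon> * (norm y powr p + norm (x - y) powr p))) \<le> norm (exp (- \<epsilon> * norm y powr p))"
    using assms by auto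
qed auto

text \<open>The rate is split as \<epsilon> = \<delta> / \<kappa> + \<gamma>. The first share yields
  the decay in \<open>x\<close>; the second, positive because the inequality for \<delta> is strict,
  keeps the integral over \<open>y\<close> finite uniformly in \<open>x\<close>.\<close>

lemma convolution_bound_strict:
  fixes p \<epsilon> \<kappa> \<delta> :: real
  assumes p: "0 < p" and "0 < \<epsilon>" "0 < \<kappa>" "0 < \<delta>" "\<delta> < \<kappa> * \<epsilon>"
    and \<kappa>: "\<And>x y::'a::euclidean_space. \<kappa> * norm x powr p \<le> norm y powr p + norm (x - y) powr p"
  obtains C where "\<And>x::'a. (LINT y|lborel. exp (- \<epsilon> * (norm y powr p + norm (x - y) powr p)))
    \<le> C * exp (- \<delta> * norm x powr p)"
proof
  fix x :: 'a
  define \<gamma> where "\<gamma> = \<epsilon> - \<delta> / \<kappa>"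
  have \<gamma>: "\<gamma> > 0" using assms by (simp add: \<gamma>_def field_simps)
  have int: "integrable lborel (\<lambda>y::'a. exp (- \<gamma> * norm y powr p))"
    using integrable_poly_exp[OF \<gamma> p, of 0, where 'a='a] by simp
  have "(LINT y|lborel. exp (- \<epsilon> * (norm y powr p + norm (x - y) powr p)))
      \<le> (LINT y|lborel. exp (- \<delta> * norm x powr p) * exp (- \<gamma> * norm (y::'a) powr p))"
  proof (rule Bochner_Integration.integral_mono)
    fix y :: 'a
    have "\<delta> * norm x powr p = \<delta> / \<kappa> * (\<kappa> * norm x powr p)"
      using assms by simp
    also have "\<dots> \<le> \<delta> / \<kappa> * (norm y powr p + norm (x - y) powr p)"
      using assms by (intro mult_left_mono) auto
    finally have "\<delta> * norm x powr p \<le> \<delta> / \<kappa> * (norm y powr p + norm (x - y) powr p)" .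
    moreover have "0 \<le> \<gamma> * norm (x - y) powr p"
      using \<gamma> by simp
    ultimately have "- \<epsilon> * (norm y powr p + norm (x - y) powr p) \<le> - \<delta> * norm x powr p + - \<gamma> * norm y powr p"
      unfolding \<gamma>_def by (simp add: algebra_simps)
    then show "exp (- \<epsilon> * (norm y powr p + norm (x - y) powr p)) \<le> exp (- \<delta> * norm x powr p) * exp (- \<gamma> * norm y powr p)"
      unfolding exp_add[symmetric] by simp
  qed (use assms integrable_exp_powr_convolution int in auto)
  then show "(LINT y|lborel. exp (- \<epsilon> * (norm y powr p + norm (x - y) powr p)))
      \<le> (LINT y|lborel. exp (- \<gamma> * norm (y::'a) powr p)) * exp (- \<delta> * norm x powr p)"
    by (simp add: mult.commute)
qed

text \<open>Completing the square gives |y|^2 + |x - y|^2 = |x|^2 / 2 + 2 |x / 2 - y|^2. The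
  dependence on \<open>x\<close> factors out exactly and the remaining integral is invariant under
  reflection and translation, so the endpoint rate is attained.\<close>

lemma convolution_bound_gaussian:
  fixes \<epsilon> :: real
  assumes "0 < \<epsilon>"
  obtains C where "\<And>x::'a::euclidean_space. (LINT y|lborel. exp (- \<epsilon> * (norm y powr 2 + norm (x - y) powr 2)))
    \<le> C * exp (- (\<epsilon> / 2) * norm x powr 2)"
proof
  fix x :: 'a
  have "- \<epsilon> * (norm y powr 2 + norm (x - y) powr 2)
      = - (\<epsilon> / 2) * norm x powr 2 + - (2 * \<epsilon>) * norm ((1 / 2) *\<^sub>R x - y) powr 2" for y
    by (simp add: power2_norm_eq_inner inner_diff_left inner_diff_right inner_commute algebra_simps)
  then have "(LINT y|lborel. exp (- \<epsilon> * (norm y powr 2 + norm (x - y) powr 2)))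
      = exp (- (\<epsilon> / 2) * norm x powr 2) * (LINT y|lborel. exp (- (2 * \<epsilon>) * norm ((1 / 2) *\<^sub>R x - y) powr 2))"
    by (simp only: exp_add integral_mult_right_zero)
  also have "(LINT y|lborel. exp (- (2 * \<epsilon>) * norm ((1 / 2) *\<^sub>R x - y) powr 2))
      = (LINT y|lborel. exp (- (2 * \<epsilon>) * norm (y::'a) powr 2))"
    by (rule integral_lborel_reflect) measurable
  finally show "(LINT y|lborel. exp (- \<epsilon> * (norm y powr 2 + norm (x - y) powr 2)))
      \<le> (LINT y|lborel. exp (- (2 * \<epsilon>) * norm (y::'a) powr 2)) * exp (- (\<epsilon> / 2) * norm x powr 2)"
    by (simp add: mult.commute)
qed

text \<open>The constant \<kappa> is 1 from the triangle inequality and 2^(1 - p) from convexity. At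
  p = 2 the latter would only reach rates strictly below \<epsilon> / 2, hence the separate Gaussian
  case.\<close>

lemma exp_powr_convolution_bound:
  fixes p \<epsilon> \<delta> :: real
  assumes "0 < p" "p \<le> 2" "0 < \<epsilon>" "0 < \<delta>"
    and "p = 2 \<Longrightarrow> \<delta> = \<epsilon> / 2"
    and "1 < p \<Longrightarrow> p < 2 \<Longrightarrow> \<delta> < 2 powr (1 - p) * \<epsilon>"
    and "p \<le> 1 \<Longrightarrow> \<delta> < \<epsilon>"
  obtains C where "\<And>x::'a::euclidean_space. (LINT y|lborel. exp (- \<epsilon> * (norm y powr p + norm (x - y) powr p)))
    \<le> C * exp (- \<delta> * norm x powr p)"
proof -
  consider "p = 2" | "1 < p" "p < 2" | "p \<le> 1" using assms(2) by linarith
  then show thesis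
  proof cases
    case 1
    then show thesis
      using convolution_bound_gaussian[OF assms(3), where 'a='a] assms(5) that by metis
  next
    case 2
    show thesis
    proof (rule convolution_bound_strict[of p \<epsilon> "2 powr (1 - p)" \<delta>, where 'a='a])
      show "2 powr (1 - p) * norm x powr p \<le> norm y powr p + norm (x - y) powr p" for x y :: 'a
        using 2 by (intro norm_powr_midpoint_le) auto
    qed (use assms 2 that in auto)
  next
    case 3
    show thesis
    proof (rule convolution_bound_strict[of p \<epsilon> 1 \<delta>, where 'a='a])
      show "1 * norm x powr p \<le> norm y powr p + norm (x - y) powr p" for x y :: 'a
        using 3 assms norm_powr_triangle[of p x y] by simp
    qed (use assms 3 that in auto)
  qed
qed

text \<open>Serves to merge a bound in \<open>x\<close> alone with a bound in \<xi> alone into one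
  in the joint variable.\<close>

lemma norm_prod_powr_le_max:
  fixes a :: "'a::real_normed_vector" and b :: "'b::real_normed_vector"
  assumes "0 < p"
  shows "norm (a, b) powr p \<le> 2 powr (p / 2) * max (norm a) (norm b) powr p"
proof -
  define m where "m = max (norm a) (norm b)"
  have m: "norm a \<le> m" "norm b \<le> m" "0 \<le> m" by (auto simp: m_def le_max_iff_disj)
  have "norm (a, b) \<le> sqrt (m\<^sup>2 + m\<^sup>2)"
    unfolding norm_Pair using m by (intro real_sqrt_le_mono add_mono power_mono) auto
  also have "\<dots> = 2 powr (1 / 2) * m"
    using m by (simp add: powr_half_sqrt real_sqrt_mult flip: mult_2)
  finally have "norm (a, b) powr p \<le> (2 powr (1 / 2) * m) powr p"
    using assms by (intro powr_mono2) auto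
  also have "\<dots> = 2 powr (p / 2) * m powr p"
    using m by (simp add: powr_mult powr_powr)
  finally show ?thesis unfolding m_def .
qed

section \<open>Integrals of functions with exponential decay\<close>

lemma integrable_poly_mult_exp_decay:
  fixes f :: "'a::euclidean_space \<Rightarrow> complex"
  assumes [measurable]: "f \<in> borel_measurable borel" and "0 < c" "0 < p"
    and le: "\<And>x. norm (f x) \<le> C * exp (- c * norm x powr p)"
  shows "integrable lborel (\<lambda>x. norm x ^ m *\<^sub>R f x)"
proof (rule Bochner_Integration.integrable_bound)
  show "integrable lborel (\<lambda>x::'a. C * (norm x ^ m * exp (- c * norm x powr p)))"
    by (intro integrable_mult_right integrable_poly_exp assms)
  have "norm (norm x ^ m *\<^sub>R f x) \<le> C * (norm x ^ m * exp (- c * norm x powr p))" for x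
    using mult_left_mono[OF le[of x], of "norm x ^ m"] by (simp add: mult_ac)
  then show "AE x in lborel. norm (norm x ^ m *\<^sub>R f x) \<le> norm (C * (norm x ^ m * exp (- c * norm x powr p)))"
    by (intro AE_I2) (metis abs_ge_self order_trans real_norm_def)
qed auto

lemma norm_integral_le:
  fixes f :: "'a \<Rightarrow> complex"
  assumes "f \<in> borel_measurable M" "integrable M g" "\<And>x. norm (f x) \<le> g x"
  shows "norm (integral\<^sup>L M f) \<le> integral\<^sup>L M g"
proof -
  have "integrable M (\<lambda>x. norm (f x))"
    by (rule Bochner_Integration.integrable_bound[OF assms(2)])
       (use assms in \<open>auto intro: order_trans[OF _ abs_ge_self]\<close>)
  then have "(LINT x|M. norm (f x)) \<le> integral\<^sup>L M g"
    using assms by (intro Bochner_Integration.integral_mono) auto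
  then show ?thesis
    using integral_norm_bound[of M f] by (rule order_trans[rotated])
qed

section \<open>The short-time Fourier transform\<close>

lemma continuous_on_fourier_transform:
  fixes K :: "'a::euclidean_space \<Rightarrow> complex"
  assumes "\<And>m. integrable lborel (\<lambda>x. norm x ^ m *\<^sub>R K x)"
  shows "continuous_on UNIV (fourier_transform K)"
  using C_infinity_fourier_transform[OF assms] unfolding C_infinity_def by (metis C_k.simps(1))

text \<open>Up to the coordinate change (a, b) to (b, -a) this is the cross-Rihaczek distribution of
  \<open>f\<close> and \<open>g\<close>.\<close>

definition stft_kernel :: "('a::euclidean_space \<Rightarrow> complex) \<Rightarrow> ('a \<Rightarrow> complex) \<Rightarrow> 'a \<times> 'a \<Rightarrow> complex" where
  "stft_kernel g f = (\<lambda>(a, b). cis (2 * pi * (a \<bullet> b)) * f b * cnj (fourier_transform g (- a)))"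

text \<open>Membership of both functions enters through continuity and four decay bounds, here with
  a common constant \<open>B\<close> and with \<open>p\<close> standing for 1 / s.\<close>

locale gelfand_shilov_pair =
  fixes f g :: "'a::euclidean_space \<Rightarrow> complex" and p \<epsilon> B :: real
  assumes p: "0 < p" "p \<le> 2" and \<epsilon>: "0 < \<epsilon>"
    and f_cont: "continuous_on UNIV f" and g_cont: "continuous_on UNIV g"
    and f_le: "norm (f x) \<le> B * exp (- \<epsilon> * norm x powr p)"
    and g_le: "norm (g x) \<le> B * exp (- \<epsilon> * norm x powr p)"
    and fhat_le: "norm (fourier_transform f x) \<le> B * exp (- \<epsilon> * norm x powr p)"
    and ghat_le: "norm (fourier_transform g x) \<le> B * exp (- \<epsilon> * norm x powr p)"
begin

lemma f_meas [measurable]: "f \<in> borel_measurable borel"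
  and g_meas [measurable]: "g \<in> borel_measurable borel"
  using f_cont g_cont by (auto intro: borel_measurable_continuous_onI)

lemma f_int: "integrable lborel (\<lambda>x. norm x ^ m *\<^sub>R f x)"
  and g_int: "integrable lborel (\<lambda>x. norm x ^ m *\<^sub>R g x)"
  using integrable_poly_mult_exp_decay[OF f_meas \<epsilon> p(1) f_le]
    integrable_poly_mult_exp_decay[OF g_meas \<epsilon> p(1) g_le] by auto

lemma ghat_cont: "continuous_on UNIV (fourier_transform g)"
  and fhat_cont: "continuous_on UNIV (fourier_transform f)"
  using continuous_on_fourier_transform f_int g_int by blast+

lemma fhat_meas [measurable]: "fourier_transform f \<in> borel_measurable borel"
  and ghat_meas [measurable]: "fourier_transform g \<in> borel_measurable borel"
  using fhat_cont ghat_cont by (auto intro: borel_measurable_continuous_onI)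

lemma ghat_int: "integrable lborel (fourier_transform g)"
  using integrable_poly_mult_exp_decay[OF ghat_meas \<epsilon> p(1) ghat_le, of 0] by simp

lemma B_nonneg: "0 \<le> B"
  using order_trans[OF norm_ge_zero f_le[of 0]] by simp

lemma g_inversion: "(LINT \<xi>|lborel. cis (2 * pi * (x \<bullet> \<xi>)) * fourier_transform g \<xi>) = g x"
proof (rule fourier_inversion[OF g_cont])
  show "norm (g x) \<le> B" for x
    using g_le[of x] by (rule order_trans) (use B_nonneg \<epsilon> in \<open>auto intro: mult_right_le_one_le\<close>)
  show "integrable lborel g"
    using g_int[of 0] by simp
qed (rule ghat_int)

lemma kernel_cont: "continuous_on UNIV (stft_kernel g f)"
proof -
  have "continuous_on UNIV (\<lambda>z. fourier_transform g (- fst z))" "continuous_on UNIV (\<lambda>z. f (snd z))"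
    by (intro continuous_on_compose2[OF ghat_cont] continuous_on_compose2[OF f_cont] continuous_intros; simp)+
  then show ?thesis
    unfolding stft_kernel_def case_prod_unfold cis_conv_exp by (intro continuous_intros)
qed

lemma kernel_meas [measurable]: "stft_kernel g f \<in> borel_measurable borel"
  using kernel_cont by (rule borel_measurable_continuous_onI)

text \<open>The phase has modulus 1, so the kernel is bounded by a product of weights in
  \<open>a\<close> and \<open>b\<close>, and \<open>norm_prod_powr_le\<close> keeps the full rate
  \<epsilon>. This gives smoothness of \<open>stft g f\<close> and later the decay of its
  transform.\<close>

lemma kernel_le: "norm (stft_kernel g f z) \<le> B\<^sup>2 * exp (- \<epsilon> * norm z powr p)"
proof (cases z)
  case (Pair a b)
  have "norm (stft_kernel g f z) = norm (f b) * norm (fourier_transform g (- a))"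
    by (simp add: Pair stft_kernel_def norm_mult)
  also have "\<dots> \<le> (B * exp (- \<epsilon> * norm b powr p)) * (B * exp (- \<epsilon> * norm (- a) powr p))"
    using f_le ghat_le[of "- a"] B_nonneg by (intro mult_mono) auto
  also have "\<dots> = B\<^sup>2 * exp (- \<epsilon> * (norm a powr p + norm b powr p))"
    by (simp add: power2_eq_square exp_add[symmetric] algebra_simps)
  also have "\<dots> \<le> B\<^sup>2 * exp (- \<epsilon> * norm z powr p)"
    using norm_prod_powr_le[OF p, of a b] \<epsilon> by (intro mult_left_mono) (auto simp: Pair)
  finally show ?thesis .
qed

lemma kernel_int: "integrable lborel (\<lambda>z. norm z ^ m *\<^sub>R stft_kernel g f z)"
  by (rule integrable_poly_mult_exp_decay[OF kernel_meas \<epsilon> p(1) kernel_le])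

text \<open>The paired form identifies Lebesgue measure on the product type with the product
  measure, so that Fubini can be applied in either order.\<close>

lemma kernel_pair_eq:
  "(\<lambda>(a, b). cis (- 2 * pi * ((x, \<xi>) \<bullet> (a, b))) * stft_kernel g f (a, b))
    = (\<lambda>z. cis (- 2 * pi * ((x, \<xi>) \<bullet> z)) * stft_kernel g f z)"
  by (auto simp: fun_eq_iff)

lemma kernel_pair_int:
  "integrable (lborel \<Otimes>\<^sub>M lborel) (\<lambda>(a, b). cis (- 2 * pi * ((x, \<xi>) \<bullet> (a, b))) * stft_kernel g f (a, b))"
proof -
  have "integrable lborel (\<lambda>z. cis (- 2 * pi * ((x, \<xi>) \<bullet> z)) * stft_kernel g f z)"
    using kernel_int[of 0] by (intro integrable_cis_mult) auto
  then show ?thesis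
    unfolding kernel_pair_eq lborel_prod .
qed

lemma kernel_transform_pair:
  "fourier_transform (stft_kernel g f) (x, \<xi>)
    = integral\<^sup>L (lborel \<Otimes>\<^sub>M lborel) (\<lambda>(a, b). cis (- 2 * pi * ((x, \<xi>) \<bullet> (a, b))) * stft_kernel g f (a, b))"
  unfolding fourier_transform_cis kernel_pair_eq lborel_prod ..

text \<open>With \<open>a\<close> integrated first, inversion for \<open>g\<close> reproduces
  \<open>cnj (g (b - x))\<close>, and the integral over \<open>b\<close> is the defining
  one.\<close>

lemma stft_eq: "stft g f = fourier_transform (stft_kernel g f)"
proof (rule ext)
  fix z :: "'a \<times> 'a"
  obtain x \<xi> where z: "z = (x, \<xi>)" by (cases z)
  \<comment> \<open>Inversion for \<open>g\<close> is conjugated and \<open>a\<close> is replaced by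
    \<open>-a\<close>, which matches the reflected argument in the kernel.\<close>
  have g_rep: "cnj (g (b - x)) = (LINT a|lborel. cis (2 * pi * (a \<bullet> (b - x))) * cnj (fourier_transform g (- a)))" for b
  proof -
    have "cnj (g (b - x)) = (LINT a|lborel. cnj (cis (2 * pi * ((b - x) \<bullet> a)) * fourier_transform g a))"
      unfolding g_inversion[of "b - x", symmetric] by (rule Bochner_Integration.integral_cnj[symmetric])
    also have "\<dots> = (LINT a|lborel. cnj (cis (2 * pi * ((b - x) \<bullet> (0 - a))) * fourier_transform g (0 - a)))"
      by (rule integral_lborel_reflect[symmetric]) measurable
    finally show ?thesis
      by (simp add: cis_cnj inner_commute)
  qed
  have "fourier_transform (stft_kernel g f) z
     = (LINT b|lborel. (LINT a|lborel. cis (- 2 * pi * ((x, \<xi>) \<bullet> (a, b))) * stft_kernel g f (a, b)))"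
    unfolding z kernel_transform_pair by (rule lborel_pair.integral_snd[OF kernel_pair_int, symmetric])
  also have "\<dots> = (LINT b|lborel. (LINT a|lborel. cis (- 2 * pi * (b \<bullet> \<xi>)) * f b
      * (cis (2 * pi * (a \<bullet> (b - x))) * cnj (fourier_transform g (- a)))))"
  proof (intro Bochner_Integration.integral_cong refl)
    fix a b
    have phase: "cis (- 2 * pi * ((x, \<xi>) \<bullet> (a, b))) * cis (2 * pi * (a \<bullet> b))
        = cis (- 2 * pi * (b \<bullet> \<xi>)) * cis (2 * pi * (a \<bullet> (b - x)))"
      by (simp add: cis_mult inner_diff_right inner_commute algebra_simps)
    have "cis (- 2 * pi * ((x, \<xi>) \<bullet> (a, b))) * stft_kernel g f (a, b)
        = (cis (- 2 * pi * ((x, \<xi>) \<bullet> (a, b))) * cis (2 * pi * (a \<bullet> b))) * (f b * cnj (fourier_transform g (- a)))"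
      unfolding stft_kernel_def prod.case by (simp only: mult_ac)
    also have "\<dots> = cis (- 2 * pi * (b \<bullet> \<xi>)) * f b * (cis (2 * pi * (a \<bullet> (b - x))) * cnj (fourier_transform g (- a)))"
      unfolding phase by (simp only: mult_ac)
    finally show "cis (- 2 * pi * ((x, \<xi>) \<bullet> (a, b))) * stft_kernel g f (a, b)
        = cis (- 2 * pi * (b \<bullet> \<xi>)) * f b * (cis (2 * pi * (a \<bullet> (b - x))) * cnj (fourier_transform g (- a)))" .
  qed
  also have "\<dots> = stft g f z"
    unfolding z stft_def prod.case exp_eq_cis g_rep by simp
  finally show "stft g f z = fourier_transform (stft_kernel g f) z" ..
qed

lemma norm_stft_le_time:
  "norm (stft g f (x, \<xi>)) \<le> B\<^sup>2 * (LINT y|lborel. exp (- \<epsilon> * (norm y powr p + norm (x - y) powr p)))"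
proof -
  have "norm (stft g f (x, \<xi>)) \<le> (LINT y|lborel. B\<^sup>2 * exp (- \<epsilon> * (norm y powr p + norm (x - y) powr p)))"
    unfolding stft_def prod.case exp_eq_cis
  proof (rule norm_integral_le)
    show "integrable lborel (\<lambda>y. B\<^sup>2 * exp (- \<epsilon> * (norm y powr p + norm (x - y) powr p)))"
      by (intro integrable_mult_right integrable_exp_powr_convolution p \<epsilon>)
    fix y
    have "norm (cis (- 2 * pi * (y \<bullet> \<xi>)) * f y * cnj (g (y - x))) = norm (f y) * norm (g (y - x))"
      by (simp add: norm_mult)
    also have "\<dots> \<le> (B * exp (- \<epsilon> * norm y powr p)) * (B * exp (- \<epsilon> * norm (y - x) powr p))"
      using f_le g_le B_nonneg by (intro mult_mono) auto
    also have "\<dots> = B\<^sup>2 * exp (- \<epsilon> * (norm y powr p + norm (x - y) powr p))"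
      by (simp add: power2_eq_square exp_add[symmetric] norm_minus_commute algebra_simps)
    finally show "norm (cis (- 2 * pi * (y \<bullet> \<xi>)) * f y * cnj (g (y - x)))
        \<le> B\<^sup>2 * exp (- \<epsilon> * (norm y powr p + norm (x - y) powr p))" .
  qed measurable
  then show ?thesis by simp
qed

text \<open>With \<open>b\<close> integrated first, the inner integral is the transform of
  \<open>f\<close> at \<xi> - a. Hence \<open>stft g f\<close> is also an integral of shifted
  products of the two transforms, and their decay plays the role that the decay of \<open>f\<close>
  and \<open>g\<close> plays in \<open>x\<close>.\<close>

lemma norm_stft_le_frequency:
  "norm (stft g f (x, \<xi>)) \<le> B\<^sup>2 * (LINT y|lborel. exp (- \<epsilon> * (norm y powr p + norm (\<xi> - y) powr p)))"
proof -
  have "stft g f (x, \<xi>) = (LINT a|lborel. (LINT b|lborel. cis (- 2 * pi * ((x, \<xi>) \<bullet> (a, b))) * stft_kernel g f (a, b)))"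
    unfolding stft_eq kernel_transform_pair by (rule lborel_pair.integral_fst[OF kernel_pair_int, symmetric])
  also have "\<dots> = (LINT a|lborel. cis (- 2 * pi * (x \<bullet> a)) * cnj (fourier_transform g (- a)) * fourier_transform f (\<xi> - a))"
  proof (intro Bochner_Integration.integral_cong refl)
    fix a
    have "cis (- 2 * pi * ((x, \<xi>) \<bullet> (a, b))) * stft_kernel g f (a, b)
        = cis (- 2 * pi * (x \<bullet> a)) * cnj (fourier_transform g (- a)) * (cis (- 2 * pi * ((\<xi> - a) \<bullet> b)) * f b)" for b
    proof -
      \<comment> \<open>Completing the character: -\<xi> \<bullet> b + a \<bullet> b = -(\<xi> - a)
        \<bullet> b.\<close>
      have phase: "cis (- 2 * pi * ((x, \<xi>) \<bullet> (a, b))) * cis (2 * pi * (a \<bullet> b))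
          = cis (- 2 * pi * (x \<bullet> a)) * cis (- 2 * pi * ((\<xi> - a) \<bullet> b))"
        by (simp add: cis_mult inner_diff_left algebra_simps)
      have "cis (- 2 * pi * ((x, \<xi>) \<bullet> (a, b))) * stft_kernel g f (a, b)
          = (cis (- 2 * pi * ((x, \<xi>) \<bullet> (a, b))) * cis (2 * pi * (a \<bullet> b))) * (f b * cnj (fourier_transform g (- a)))"
        unfolding stft_kernel_def prod.case by (simp only: mult_ac)
      then show ?thesis
        unfolding phase by (simp only: mult_ac)
    qed
    then show "(LINT b|lborel. cis (- 2 * pi * ((x, \<xi>) \<bullet> (a, b))) * stft_kernel g f (a, b))
        = cis (- 2 * pi * (x \<bullet> a)) * cnj (fourier_transform g (- a)) * fourier_transform f (\<xi> - a)"
      unfolding fourier_transform_cis[of f] by (simp only: integral_mult_right_zero)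
  qed
  also have "norm \<dots> \<le> (LINT a|lborel. B\<^sup>2 * exp (- \<epsilon> * (norm a powr p + norm (\<xi> - a) powr p)))"
  proof (rule norm_integral_le)
    show "integrable lborel (\<lambda>a. B\<^sup>2 * exp (- \<epsilon> * (norm a powr p + norm (\<xi> - a) powr p)))"
      by (intro integrable_mult_right integrable_exp_powr_convolution p \<epsilon>)
    fix a
    have "norm (cis (- 2 * pi * (x \<bullet> a)) * cnj (fourier_transform g (- a)) * fourier_transform f (\<xi> - a))
        = norm (fourier_transform g (- a)) * norm (fourier_transform f (\<xi> - a))"
      by (simp add: norm_mult)
    also have "\<dots> \<le> (B * exp (- \<epsilon> * norm (- a) powr p)) * (B * exp (- \<epsilon> * norm (\<xi> - a) powr p))"
      using fhat_le ghat_le[of "- a"] B_nonneg by (intro mult_mono) auto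
    also have "\<dots> = B\<^sup>2 * exp (- \<epsilon> * (norm a powr p + norm (\<xi> - a) powr p))"
      by (simp add: power2_eq_square exp_add[symmetric] algebra_simps)
    finally show "norm (cis (- 2 * pi * (x \<bullet> a)) * cnj (fourier_transform g (- a)) * fourier_transform f (\<xi> - a))
        \<le> B\<^sup>2 * exp (- \<epsilon> * (norm a powr p + norm (\<xi> - a) powr p))" .
  qed measurable
  finally show ?thesis by simp
qed

lemma stft_decay:
  assumes "0 < \<delta>"
    and "p = 2 \<Longrightarrow> 2 powr (p / 2) * \<delta> = \<epsilon> / 2"
    and "1 < p \<Longrightarrow> p < 2 \<Longrightarrow> 2 powr (p / 2) * \<delta> < 2 powr (1 - p) * \<epsilon>"
    and "p \<le> 1 \<Longrightarrow> 2 powr (p / 2) * \<delta> < \<epsilon>"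
  obtains C where "\<And>z. norm (stft g f z) \<le> C * exp (- \<delta> * norm z powr p)"
proof -
  \<comment> \<open>This is the rate required at the larger of |x| and |\<xi>|, since |z|^p is at
    most 2^(p / 2) times its p-th power.\<close>
  define \<delta>' where "\<delta>' = 2 powr (p / 2) * \<delta>"
  have \<delta>': "\<delta>' > 0" using assms(1) by (simp add: \<delta>'_def)
  obtain C where C: "\<And>x::'a. (LINT y|lborel. exp (- \<epsilon> * (norm y powr p + norm (x - y) powr p)))
      \<le> C * exp (- \<delta>' * norm x powr p)"
    by (rule exp_powr_convolution_bound[where 'a='a, OF p \<epsilon> \<delta>' assms(2-4)[folded \<delta>'_def]]) (assumption | rule that)+
  show thesis
  proof (rule that[of "B\<^sup>2 * C"])
    fix z :: "'a \<times> 'a"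
    obtain x \<xi> where z: "z = (x, \<xi>)" by (cases z)
    \<comment> \<open>At the origin \<open>C\<close> bounds a nonnegative integral; its sign is
      needed for the monotonicity step below.\<close>
    have "0 \<le> (LINT y|lborel. exp (- \<epsilon> * (norm y powr p + norm ((0::'a) - y) powr p)))"
      by simp
    from order_trans[OF this C[of 0]] have C0: "0 \<le> C" by simp
    have "norm (stft g f z) \<le> B\<^sup>2 * (C * exp (- \<delta>' * norm x powr p))"
      "norm (stft g f z) \<le> B\<^sup>2 * (C * exp (- \<delta>' * norm \<xi> powr p))"
      unfolding z
      by (rule order_trans[OF norm_stft_le_time] order_trans[OF norm_stft_le_frequency],
          intro mult_left_mono C zero_le_power2)+
    then have "norm (stft g f z) \<le> B\<^sup>2 * (C * exp (- \<delta>' * max (norm x) (norm \<xi>) powr p))"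
      by (cases "norm x \<le> norm \<xi>") (auto simp: max_def)
    also have "\<dots> \<le> B\<^sup>2 * (C * exp (- \<delta> * norm z powr p))"
    proof (intro mult_left_mono C0 zero_le_power2)
      have "\<delta> * norm z powr p \<le> \<delta> * (2 powr (p / 2) * max (norm x) (norm \<xi>) powr p)"
        using assms(1) p norm_prod_powr_le_max[of p x \<xi>] by (intro mult_left_mono) (auto simp: z)
      then show "exp (- \<delta>' * max (norm x) (norm \<xi>) powr p) \<le> exp (- \<delta> * norm z powr p)"
        by (simp add: \<delta>'_def mult_ac)
    qed
    finally show "norm (stft g f z) \<le> B\<^sup>2 * C * exp (- \<delta> * norm z powr p)"
      by (simp add: mult.assoc)
  qed
qed

lemma C_infinity_stft: "C_infinity (stft g f)"
  unfolding stft_eq by (rule C_infinity_fourier_transform[OF kernel_int])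

text \<open>Inversion for the kernel at \<open>- z\<close>: the sign change turns the inverse
  character into the forward one. The assumed decay provides the integrability of
  \<open>stft g f\<close> that inversion requires.\<close>

lemma fourier_transform_stft:
  assumes "0 < \<delta>" and le: "\<And>z. norm (stft g f z) \<le> C * exp (- \<delta> * norm z powr p)"
  shows "fourier_transform (stft g f) z = stft_kernel g f (- z)"
proof -
  have meas: "stft g f \<in> borel_measurable borel"
    unfolding stft_eq
    by (rule borel_measurable_continuous_onI[OF continuous_on_fourier_transform[OF kernel_int]])
  have "(LINT w|lborel. cis (2 * pi * ((- z) \<bullet> w)) * fourier_transform (stft_kernel g f) w) = stft_kernel g f (- z)"
  proof (rule fourier_inversion[OF kernel_cont])
    show "norm (stft_kernel g f z) \<le> B\<^sup>2" for z
      using kernel_le[of z] by (rule order_trans) (use \<epsilon> in \<open>auto intro: mult_right_le_one_le\<close>)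
    show "integrable lborel (stft_kernel g f)"
      using kernel_int[of 0] by simp
    show "integrable lborel (fourier_transform (stft_kernel g f))"
      using integrable_poly_mult_exp_decay[OF meas assms(1) p(1) le, of 0] by (simp add: stft_eq)
  qed
  then show ?thesis
    unfolding fourier_transform_cis[of "stft g f"] by (simp add: stft_eq)
qed

end

section \<open>Translation between the function space and decay bounds, and conclusion\<close>

lemma gelfand_shilovI:
  assumes "C_infinity f"
    and "\<And>x. norm (f x) \<le> C * exp (- \<epsilon> * norm x powr (1 / s))"
    and "\<And>x. norm (fourier_transform f x) \<le> D * exp (- \<epsilon> * norm x powr (1 / s))"
  shows "f \<in> gelfand_shilov s \<epsilon>"
  unfolding gelfand_shilov_def bdd_above_def
  using assms by (auto simp: exp_minus field_simps)

lemma gelfand_shilovD: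
  assumes "f \<in> gelfand_shilov s \<epsilon>"
  shows "continuous_on UNIV f"
    and "\<exists>C. \<forall>x. norm (f x) \<le> C * exp (- \<epsilon> * norm x powr (1 / s)) \<and>
      norm (fourier_transform f x) \<le> C * exp (- \<epsilon> * norm x powr (1 / s))"
proof -
  have "C_k 0 f"
    using assms unfolding gelfand_shilov_def C_infinity_def by blast
  then show "continuous_on UNIV f" by simp
  obtain C D where CD: "\<And>x. norm (f x) * exp (\<epsilon> * norm x powr (1 / s)) \<le> C"
    "\<And>x. norm (fourier_transform f x) * exp (\<epsilon> * norm x powr (1 / s)) \<le> D"
    using assms unfolding gelfand_shilov_def bdd_above_def by auto
  have "norm (f x) \<le> max C D * exp (- \<epsilon> * norm x powr (1 / s))"
    "norm (fourier_transform f x) \<le> max C D * exp (- \<epsilon> * norm x powr (1 / s))" for x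
    using CD(1)[of x] CD(2)[of x] by (auto simp: exp_minus field_simps le_max_iff_disj)
  then show "\<exists>C. \<forall>x. norm (f x) \<le> C * exp (- \<epsilon> * norm x powr (1 / s)) \<and>
      norm (fourier_transform f x) \<le> C * exp (- \<epsilon> * norm x powr (1 / s))"
    by blast
qed

theorem theorem1p2:
  fixes f g :: "real ^ 'd \<Rightarrow> complex"
    and s \<epsilon> \<delta> :: real
  assumes "s \<ge> 1 / 2"
    and "\<epsilon> > 0"
    and "f \<in> gelfand_shilov s \<epsilon>"
    and "g \<in> gelfand_shilov s \<epsilon>"
    and "\<delta> > 0"
    and "s = 1 / 2 \<Longrightarrow> \<delta> = \<epsilon> / 4"
    and "1 / 2 < s \<Longrightarrow> s < 1 \<Longrightarrow> \<delta> < 2 powr (1 - 3 / (2 * s)) * \<epsilon>"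
    and "s \<ge> 1 \<Longrightarrow> \<delta> < 2 powr (- 1 / (2 * s)) * \<epsilon>"
  shows "stft g f \<in> gelfand_shilov s \<delta>"
proof -
  define p where "p = 1 / s"
  have p: "0 < p" "p \<le> 2" using assms(1) by (auto simp: p_def field_simps)
  obtain C1 C2 where C: "\<And>x. norm (f x) \<le> C1 * exp (- \<epsilon> * norm x powr p)"
      "\<And>x. norm (fourier_transform f x) \<le> C1 * exp (- \<epsilon> * norm x powr p)"
      "\<And>x. norm (g x) \<le> C2 * exp (- \<epsilon> * norm x powr p)"
      "\<And>x. norm (fourier_transform g x) \<le> C2 * exp (- \<epsilon> * norm x powr p)"
    using gelfand_shilovD(2)[OF assms(3)] gelfand_shilovD(2)[OF assms(4)] unfolding p_def by metis
  have "C1 * exp (- \<epsilon> * t) \<le> max C1 C2 * exp (- \<epsilon> * t)" "C2 * exp (- \<epsilon> * t) \<le> max C1 C2 * exp (- \<epsilon> * t)" for t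
    by (auto intro!: mult_right_mono)
  then interpret gelfand_shilov_pair f g p \<epsilon> "max C1 C2"
    using p assms gelfand_shilovD(1) by unfold_locales (blast intro: order_trans C)+
  \<comment> \<open>Passing to the joint variable costs 2^(p / 2); the hypotheses on \<delta> are
    multiplied by this factor to reach the form expected by \<open>stft_decay\<close>.\<close>
  have powr_shift: "2 powr (p / 2) * \<delta> < 2 powr (p / 2 + q) * \<epsilon>" if "\<delta> < 2 powr q * \<epsilon>" for q
    using mult_strict_left_mono[OF that, of "2 powr (p / 2)"] by (simp add: powr_add mult.assoc)
  obtain C where C: "\<And>z. norm (stft g f z) \<le> C * exp (- \<delta> * norm z powr p)"
  proof (rule stft_decay[OF assms(5)])
    show "2 powr (p / 2) * \<delta> = \<epsilon> / 2" if "p = 2"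
    proof -
      have "s = 1 / p" by (simp add: p_def)
      then have "s = 1 / 2" using that by simp
      then show ?thesis using assms(6) that by simp
    qed
    show "2 powr (p / 2) * \<delta> < 2 powr (1 - p) * \<epsilon>" if "1 < p" "p < 2"
    proof -
      have "1 / 2 < s" "s < 1" using that assms(1) by (auto simp: p_def field_simps)
      from powr_shift[OF assms(7)[OF this]]
      have "2 powr (p / 2) * \<delta> < 2 powr (p / 2 + (1 - 3 / (2 * s))) * \<epsilon>" .
      \<comment> \<open>As 3 / (2 s) = 3 p / 2, the exponent becomes exactly that of the convexity
        constant.\<close>
      also have "p / 2 + (1 - 3 / (2 * s)) = 1 - p" using assms(1) by (simp add: p_def field_simps)
      finally show ?thesis .
    qed
    show "2 powr (p / 2) * \<delta> < \<epsilon>" if "p \<le> 1"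
    proof -
      have "s \<ge> 1" using that assms(1) by (auto simp: p_def field_simps)
      from powr_shift[OF assms(8)[OF this]]
      have "2 powr (p / 2) * \<delta> < 2 powr (p / 2 + - 1 / (2 * s)) * \<epsilon>" .
      also have "p / 2 + - 1 / (2 * s) = 0" using assms(1) by (simp add: p_def field_simps)
      finally show ?thesis by simp
    qed
  qed (rule that)
  have le: "2 powr q * \<epsilon> \<le> \<epsilon>" if "q \<le> 0" for q
    using powr_mono[OF that, of 2] assms(2) by (intro mult_left_le_one_le) auto
  \<comment> \<open>The transform of \<open>stft g f\<close> decays at rate \<epsilon>, whereas the
    target space asks for \<delta>; in each range of \<open>s\<close> the admissible rates do not
    exceed \<epsilon>.\<close>
  have "\<delta> \<le> \<epsilon>"
  proof -
    consider "s = 1 / 2" | "1 / 2 < s" "s < 1" | "s \<ge> 1" using assms(1) by linarith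
    then show ?thesis
    proof cases
      case 1 then show ?thesis using assms(2,6) by simp
    next
      case 2
      then show ?thesis using assms(7) le[of "1 - 3 / (2 * s)"] by (auto simp: field_simps)
    next
      case 3
      then show ?thesis using assms(8) le[of "- 1 / (2 * s)"] by (auto simp: field_simps)
    qed
  qed
  show ?thesis
  proof (rule gelfand_shilovI[OF C_infinity_stft])
    show "norm (stft g f z) \<le> C * exp (- \<delta> * norm z powr (1 / s))" for z
      using C[of z] by (simp add: p_def)
    show "norm (fourier_transform (stft g f) z) \<le> (max C1 C2)\<^sup>2 * exp (- \<delta> * norm z powr (1 / s))" for z
    proof -
      have "norm (fourier_transform (stft g f) z) \<le> (max C1 C2)\<^sup>2 * exp (- \<epsilon> * norm (- z) powr p)"
        unfolding fourier_transform_stft[OF assms(5) C] by (rule kernel_le)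
      also have "\<dots> \<le> (max C1 C2)\<^sup>2 * exp (- \<delta> * norm z powr (1 / s))"
        using \<open>\<delta> \<le> \<epsilon>\<close> by (intro mult_left_mono) (auto simp: p_def mult_right_mono)
      finally show ?thesis .
    qed
  qed
qed

end
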